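(* (Exact preservation of isothermal hydrostatic equilibria.) Consider the two-dimensional Euler equations with gravitational potential $\phi$, discretized with the global-flux quadrature on continuous $\mathbb Q^K$ Gauss--Lobatto elements. Let $E_{ij}$ be an element and let $\bar\rho,\bar p>0$ be reference values. On $E_{ij}$ let the discrete gravity term be $$(\rho\nabla\phi)_h(\mathbf x):=-\frac{\bar p}{\bar\rho}\sum_{\alpha,\beta}\varphi_\alpha(\mathbf x)\,e^{\kappa_\alpha/\bar p}\,\nabla\varphi_\beta(\mathbf x)\,e^{-\bar\rho\,\phi_\beta/\bar p},\qquad \kappa_\alpha:=\bar p\ln\rho_\alpha+\bar\rho\,\phi_\alpha,$$ where $\alpha,\beta$ run over the nodes of $E_{ij}$ and $\phi_\alpha=\phi(\mathbf x_\alpha)$. Suppose the nodal data on $E_{ij}$ form an isothermal hydrostatic equilibrium, i.e. $\mathbf v_\alpha=0$, $p_\alpha/\bar p=\rho_\alpha/\bar\rho$ and $\kappa_\alpha=\kappa_0$ for all nodes $\alpha$ of $E_{ij}$, with $\kappa_0$ a constant. Then $$\nabla p_h(\mathbf x)=-(\rho\nabla\phi)_h(\mathbf x)\quad\text{for all }\mathbf x\in E_{ij},\qquad p_h=\sum_\beta\varphi_\beta p_\beta,$$ and consequently the element residuals vanish exactly: $\Psi^{ij}_{pq}+\mathcal S^{ij}_{pq}=0$ for all $p,q=0,\dots,K$.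
   Context: Equations. $\partial_t\mathbf W+\partial_{x^1}\mathbf F_1+\partial_{x^2}\mathbf F_2=\mathbf S$ with $\mathbf W=(\rho,\rho v_1,\rho v_2,\rho E)$, $\mathbf F_1=(\rho v_1,\rho v_1^2+p,\rho v_1v_2,\rho v_1H)$, $\mathbf F_2=(\rho v_2,\rho v_1v_2,\rho v_2^2+p,\rho v_2H)$, $\mathbf S=(0,-\rho\,\partial_{x^1}\phi,-\rho\,\partial_{x^2}\phi,-\rho\,\mathbf v\cdot\nabla\phi)$, $H=E+p/\rho$, $p=(\gamma-1)\rho(E-|\mathbf v|^2/2)$, and $\phi$ a given function of $\mathbf x$. Elements. $E_{ij}=[x^1_i,x^1_{i+1}]\times[x^2_j,x^2_{j+1}]$ carries the tensor-product Gauss--Lobatto nodes $(x^1_{i,p},x^2_{j,q})$, $p,q=0,\dots,K$, with $x^1_{i,0}=x^1_i$, $x^1_{i,K}=x^1_{i+1}$ and similarly for $x^2$. $\varphi_\alpha$ is the $\mathbb Q^K$ Lagrange basis of $E_{ij}$ at these nodes. $\mathbf F_{m,h}$ is the nodal interpolant in $\mathbb Q^K$ of the flux $\mathbf F_m$. The discrete source $\mathbf S_h$ on $E_{ij}$ is the $\mathbb Q^K$ interpolant of nodal source values in which $\rho\nabla\phi$ is replaced by the nodal values (from inside $E_{ij}$) of $(\rho\nabla\phi)_h$, and the energy source by $-\mathbf v_\alpha\cdot(\rho\nabla\phi)_h(\mathbf x_\alpha)$. Residual arrays on $E_{ij}$: $$\Psi^{ij}_{pq}=\int_{x^2_{j,0}}^{x^2_{j,q}}\int_{x^1_{i,0}}^{x^1_{i,p}}(\partial_{x^1}\mathbf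 F_{1,h}+\partial_{x^2}\mathbf F_{2,h})\,dx^1dx^2,\qquad \mathcal S^{ij}_{pq}=-\int_{x^2_{j,0}}^{x^2_{j,q}}\int_{x^1_{i,0}}^{x^1_{i,p}}\mathbf S_h\,dx^1dx^2 .$$ In practice the reference values may be chosen element by element. *)

theory Defs
  imports "HOL-Analysis.Analysis" "HOL-Computational_Algebra.Polynomial"
begin

subsection \<open>Partial derivatives and gradient\<close>

definition pderivative :: "2 \<Rightarrow> (real^2 \<Rightarrow> 'a::real_normed_vector) \<Rightarrow> real^2 \<Rightarrow> 'a" where
  "pderivative m f x = vector_derivative (\<lambda>h. f (x + h *\<^sub>R axis m 1)) (at 0)"

definition grad :: "(real^2 \<Rightarrow> real) \<Rightarrow> real^2 \<Rightarrow> real^2" where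
  "grad f x = (\<chi> m. pderivative m f x)"


subsection \<open>Euler equations\<close>

text \<open>A state is the vector of conserved variables
  \<open>W = (\<rho>, \<rho> v\<^sub>1, \<rho> v\<^sub>2, \<rho> E)\<close>.\<close>

definition mass_density :: "real^4 \<Rightarrow> real" where
  "mass_density W = W$1"

definition velocity :: "real^4 \<Rightarrow> real^2" where
  "velocity W = vector [W$2 / W$1, W$3 / W$1]"

definition energy :: "real^4 \<Rightarrow> real" where
  "energy W = W$4 / W$1"

definition pressure :: "real \<Rightarrow> real^4 \<Rightarrow> real" where
  "pressure \<gamma> W = (\<gamma> - 1) * mass_density W * (energy W - (norm (velocity W))\<^sup>2 / 2)"

definition enthalpy :: "real \<Rightarrow> real^4 \<Rightarrow> real" where
  "enthalpy \<gamma> W = energy W + pressure \<gamma> W / mass_density W"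

definition flux1 :: "real \<Rightarrow> real^4 \<Rightarrow> real^4" where
  "flux1 \<gamma> W = (let \<rho> = mass_density W; v = velocity W in
     vector [\<rho> * v$1, \<rho> * (v$1)\<^sup>2 + pressure \<gamma> W, \<rho> * v$1 * v$2, \<rho> * v$1 * enthalpy \<gamma> W])"

definition flux2 :: "real \<Rightarrow> real^4 \<Rightarrow> real^4" where
  "flux2 \<gamma> W = (let \<rho> = mass_density W; v = velocity W in
     vector [\<rho> * v$2, \<rho> * v$1 * v$2, \<rho> * (v$2)\<^sup>2 + pressure \<gamma> W, \<rho> * v$2 * enthalpy \<gamma> W])"

text \<open>The source at a state \<open>W\<close>, with the vector \<open>g\<close> in the place of \<open>\<rho> \<nabla>\<phi>\<close>.\<close>

definition source :: "real^4 \<Rightarrow> real^2 \<Rightarrow> real^4" where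
  "source W g = vector [0, - g$1, - g$2, - (velocity W \<bullet> g)]"


subsection \<open>Gauss--Lobatto elements\<close>

text \<open>Rodrigues' formula.\<close>

definition legendre :: "nat \<Rightarrow> real poly" where
  "legendre n = smult (1 / (2 ^ n * fact n)) ((pderiv ^^ n) ([:-1, 0, 1:] ^ n))"

definition gauss_lobatto :: "nat \<Rightarrow> (nat \<Rightarrow> real) \<Rightarrow> bool" where
  "gauss_lobatto K \<xi> \<longleftrightarrow>
     strict_mono_on {..K} \<xi> \<and> \<xi> 0 = -1 \<and> \<xi> K = 1 \<and>
     (\<forall>p\<in>{0<..<K}. poly (pderiv (legendre K)) (\<xi> p) = 0)"

text \<open>The nodes of \<open>[x\<^sub>i, x\<^sub>i\<^sub>+\<^sub>1]\<close> are the affine images of the reference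
  nodes on \<open>[-1, 1]\<close>.\<close>

definition cell_node :: "(nat \<Rightarrow> real) \<Rightarrow> (nat \<Rightarrow> real) \<Rightarrow> nat \<Rightarrow> nat \<Rightarrow> real" where
  "cell_node \<xi> x i p = x i + (x (Suc i) - x i) * (\<xi> p + 1) / 2"

definition element :: "(nat \<Rightarrow> real) \<Rightarrow> (nat \<Rightarrow> real) \<Rightarrow> nat \<Rightarrow> nat \<Rightarrow> (real^2) set" where
  "element x1 x2 i j = cbox (vector [x1 i, x2 j]) (vector [x1 (Suc i), x2 (Suc j)])"

text \<open>Below, \<open>s\<close> and \<open>t\<close> are the one-dimensional nodes of one element in the two
  coordinate directions. A node index \<open>\<alpha>\<close> is a pair \<open>(p, q)\<close>.\<close>

definition node_index :: "nat \<Rightarrow> (nat \<times> nat) set" where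
  "node_index K = {..K} \<times> {..K}"

definition node :: "(nat \<Rightarrow> real) \<Rightarrow> (nat \<Rightarrow> real) \<Rightarrow> nat \<times> nat \<Rightarrow> real^2" where
  "node s t \<alpha> = vector [s (fst \<alpha>), t (snd \<alpha>)]"

definition lagrange :: "nat \<Rightarrow> (nat \<Rightarrow> real) \<Rightarrow> nat \<Rightarrow> real \<Rightarrow> real" where
  "lagrange K t p y = (\<Prod>q\<in>{..K} - {p}. (y - t q) / (t p - t q))"

definition basis :: "nat \<Rightarrow> (nat \<Rightarrow> real) \<Rightarrow> (nat \<Rightarrow> real) \<Rightarrow> nat \<times> nat \<Rightarrow> real^2 \<Rightarrow> real" where
  "basis K s t \<alpha> x = lagrange K s (fst \<alpha>) (x$1) * lagrange K t (snd \<alpha>) (x$2)"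

definition interpolant ::
  "nat \<Rightarrow> (nat \<Rightarrow> real) \<Rightarrow> (nat \<Rightarrow> real) \<Rightarrow> (nat \<times> nat \<Rightarrow> 'a::real_vector) \<Rightarrow> real^2 \<Rightarrow> 'a" where
  "interpolant K s t u x = (\<Sum>\<alpha>\<in>node_index K. basis K s t \<alpha> x *\<^sub>R u \<alpha>)"


subsection \<open>Discrete gravity and residuals\<close>

text \<open>The nodal data are given by functions \<open>W\<close>, \<open>\<phi>\<close> of the position, of which only the
  values at the nodes are used. A node shared by several elements thus carries one value, as it
  does in a continuous finite element space. On an element, basis functions and interpolants are
  polynomials on the whole plane, so that derivatives on the boundary of the element are those
  from its inside.\<close>

definition kappa :: "real \<Rightarrow> real \<Rightarrow> real \<Rightarrow> real \<Rightarrow> real" where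
  "kappa \<rho>\<^sub>r p\<^sub>r \<rho> \<phi> = p\<^sub>r * ln \<rho> + \<rho>\<^sub>r * \<phi>"

definition gravity ::
  "nat \<Rightarrow> (nat \<Rightarrow> real) \<Rightarrow> (nat \<Rightarrow> real) \<Rightarrow> real \<Rightarrow> real \<Rightarrow>
    (real^2 \<Rightarrow> real^4) \<Rightarrow> (real^2 \<Rightarrow> real) \<Rightarrow> real^2 \<Rightarrow> real^2" where
  "gravity K s t \<rho>\<^sub>r p\<^sub>r W \<phi> x =
     - (p\<^sub>r / \<rho>\<^sub>r) *\<^sub>R
       (\<Sum>\<alpha>\<in>node_index K. \<Sum>\<beta>\<in>node_index K.
          (basis K s t \<alpha> x
            * exp (kappa \<rho>\<^sub>r p\<^sub>r (mass_density (W (node s t \<alpha>))) (\<phi> (node s t \<alpha>)) / p\<^sub>r)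
            * exp (- \<rho>\<^sub>r * \<phi> (node s t \<beta>) / p\<^sub>r)) *\<^sub>R grad (basis K s t \<beta>) x)"

definition pressure_h ::
  "nat \<Rightarrow> (nat \<Rightarrow> real) \<Rightarrow> (nat \<Rightarrow> real) \<Rightarrow> real \<Rightarrow> (real^2 \<Rightarrow> real^4) \<Rightarrow> real^2 \<Rightarrow> real" where
  "pressure_h K s t \<gamma> W = interpolant K s t (\<lambda>\<alpha>. pressure \<gamma> (W (node s t \<alpha>)))"

definition flux1_h ::
  "nat \<Rightarrow> (nat \<Rightarrow> real) \<Rightarrow> (nat \<Rightarrow> real) \<Rightarrow> real \<Rightarrow> (real^2 \<Rightarrow> real^4) \<Rightarrow> real^2 \<Rightarrow> real^4" where
  "flux1_h K s t \<gamma> W = interpolant K s t (\<lambda>\<alpha>. flux1 \<gamma> (W (node s t \<alpha>)))"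

definition flux2_h ::
  "nat \<Rightarrow> (nat \<Rightarrow> real) \<Rightarrow> (nat \<Rightarrow> real) \<Rightarrow> real \<Rightarrow> (real^2 \<Rightarrow> real^4) \<Rightarrow> real^2 \<Rightarrow> real^4" where
  "flux2_h K s t \<gamma> W = interpolant K s t (\<lambda>\<alpha>. flux2 \<gamma> (W (node s t \<alpha>)))"

definition source_h ::
  "nat \<Rightarrow> (nat \<Rightarrow> real) \<Rightarrow> (nat \<Rightarrow> real) \<Rightarrow> real \<Rightarrow> real \<Rightarrow>
    (real^2 \<Rightarrow> real^4) \<Rightarrow> (real^2 \<Rightarrow> real) \<Rightarrow> real^2 \<Rightarrow> real^4" where
  "source_h K s t \<rho>\<^sub>r p\<^sub>r W \<phi> =
     interpolant K s t
       (\<lambda>\<alpha>. source (W (node s t \<alpha>)) (gravity K s t \<rho>\<^sub>r p\<^sub>r W \<phi> (node s t \<alpha>)))"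

definition flux_residual ::
  "nat \<Rightarrow> (nat \<Rightarrow> real) \<Rightarrow> (nat \<Rightarrow> real) \<Rightarrow> real \<Rightarrow> (real^2 \<Rightarrow> real^4) \<Rightarrow> nat \<Rightarrow> nat \<Rightarrow> real^4" where
  "flux_residual K s t \<gamma> W p q =
     integral {t 0..t q} (\<lambda>y. integral {s 0..s p} (\<lambda>x.
       pderivative 1 (flux1_h K s t \<gamma> W) (vector [x, y])
       + pderivative 2 (flux2_h K s t \<gamma> W) (vector [x, y])))"

definition source_residual ::
  "nat \<Rightarrow> (nat \<Rightarrow> real) \<Rightarrow> (nat \<Rightarrow> real) \<Rightarrow> real \<Rightarrow> real \<Rightarrow>
    (real^2 \<Rightarrow> real^4) \<Rightarrow> (real^2 \<Rightarrow> real) \<Rightarrow> nat \<Rightarrow> nat \<Rightarrow> real^4" where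
  "source_residual K s t \<rho>\<^sub>r p\<^sub>r W \<phi> p q =
     - integral {t 0..t q} (\<lambda>y. integral {s 0..s p} (\<lambda>x.
         source_h K s t \<rho>\<^sub>r p\<^sub>r W \<phi> (vector [x, y])))"

end

theory Submission
  imports Defs
begin

text \<open>With \<open>\<kappa>\<close> constant at the nodes, the factor \<open>exp (\<kappa> / p\<^sub>r)\<close> leaves the first sum of the
  discrete gravity term, which is then a partition of unity. What remains is the gradient of the
  interpolant of \<open>exp (\<kappa> / p\<^sub>r) exp (- \<rho>\<^sub>r \<phi> / p\<^sub>r)\<close>, that is, of the nodal densities, and these are
  proportional to the nodal pressures. At rest, the fluxes reduce to the pressure. Since
  \<open>\<partial>\<^sub>m p\<^sub>h\<close> belongs to \<open>Q\<^sup>K\<close>, interpolating the source at the nodes reproduces \<open>\<partial>\<^sub>m p\<^sub>h\<close>, so that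
  the integrands of the two residuals agree pointwise.\<close>

section \<open>Lagrange interpolation in one variable\<close>

text \<open>\<open>lagrange\<close> is a bare function; this polynomial version gives access to
  \<open>degree\<close> and \<open>pderiv\<close>.\<close>

definition lagrange_poly :: "nat \<Rightarrow> (nat \<Rightarrow> real) \<Rightarrow> nat \<Rightarrow> real poly" where
  "lagrange_poly K t p = (\<Prod>q\<in>{..K} - {p}. smult (1 / (t p - t q)) [:- t q, 1:])"

lemma poly_lagrange_poly: "poly (lagrange_poly K t p) y = lagrange K t p y"
  by (simp add: lagrange_poly_def lagrange_def poly_prod diff_divide_distrib)

lemma degree_lagrange_poly:
  assumes "p \<le> K"
  shows "degree (lagrange_poly K t p) \<le> K"
proof -
  have "degree (lagrange_poly K t p)
      \<le> sum (degree \<circ> (\<lambda>q. smult (1 / (t p - t q)) [:- t q, 1:])) ({..K} - {p})"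
    unfolding lagrange_poly_def by (rule degree_prod_sum_le) simp
  also have "\<dots> \<le> (\<Sum>q\<in>{..K} - {p}. 1)"
    by (rule sum_mono) simp
  also have "\<dots> = K"
    using assms by simp
  finally show ?thesis .
qed

lemma lagrange_node:
  assumes "inj_on t {..K}" "p \<le> K" "r \<le> K"
  shows "lagrange K t p (t r) = (if r = p then 1 else 0)"
proof (cases "r = p")
  case True
  have "t p \<noteq> t q" if "q \<in> {..K} - {p}" for q
    using assms that by (auto simp: inj_on_def)
  then show ?thesis
    using True by (simp add: lagrange_def)
next
  case False
  then show ?thesis
    using assms by (auto simp: lagrange_def)
qed

lemma lagrange_interpolation_exact:
  assumes inj: "inj_on t {..K}" and deg: "degree a \<le> K"
  shows "(\<Sum>p\<le>K. lagrange K t p y * poly a (t p)) = poly a y"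
proof -
  define b where "b = (\<Sum>p\<le>K. smult (poly a (t p)) (lagrange_poly K t p))"
  have poly_b: "poly b z = (\<Sum>p\<le>K. lagrange K t p z * poly a (t p))" for z
    by (simp add: b_def poly_sum poly_lagrange_poly mult.commute)
  have "b = a"
  proof (rule poly_eqI_degree[of "t ` {..K}"])
    fix z assume "z \<in> t ` {..K}"
    then obtain r where r: "r \<le> K" "z = t r" by auto
    have "poly b (t r) = (\<Sum>p\<le>K. if r = p then poly a (t p) else 0)"
      unfolding poly_b by (rule sum.cong) (use inj r in \<open>auto simp: lagrange_node\<close>)
    then show "poly b z = poly a z"
      using r by simp
  next
    have "degree b \<le> K"
      unfolding b_def
      by (rule degree_sum_le) (auto intro: degree_lagrange_poly)
    then show "degree b < card (t ` {..K})"
      by (simp add: card_image inj)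
  next
    show "degree a < card (t ` {..K})"
      using deg by (simp add: card_image inj)
  qed
  then show ?thesis
    by (simp add: poly_b[symmetric])
qed

section \<open>Tensor-product interpolation\<close>

text \<open>For separated nodal values the sum over index pairs factors into two one-dimensional
  interpolation sums, and each of these is exact.\<close>

lemma interpolant_tensor:
  fixes c :: "'a::real_vector"
  assumes "inj_on s {..K}" "inj_on t {..K}" "degree a \<le> K" "degree b \<le> K"
  shows "interpolant K s t (\<lambda>\<alpha>. (poly a (s (fst \<alpha>)) * poly b (t (snd \<alpha>))) *\<^sub>R c) x
    = (poly a (x$1) * poly b (x$2)) *\<^sub>R c"
proof -
  have "interpolant K s t (\<lambda>\<alpha>. (poly a (s (fst \<alpha>)) * poly b (t (snd \<alpha>))) *\<^sub>R c) x
    = (\<Sum>\<alpha>\<in>{..K} \<times> {..K}. (lagrange K s (fst \<alpha>) (x$1) * poly a (s (fst \<alpha>)))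
        * (lagrange K t (snd \<alpha>) (x$2) * poly b (t (snd \<alpha>)))) *\<^sub>R c"
    by (simp add: interpolant_def node_index_def basis_def scaleR_sum_left mult_ac)
  also have "(\<Sum>\<alpha>\<in>{..K} \<times> {..K}. (lagrange K s (fst \<alpha>) (x$1) * poly a (s (fst \<alpha>)))
        * (lagrange K t (snd \<alpha>) (x$2) * poly b (t (snd \<alpha>))))
    = (\<Sum>p\<le>K. lagrange K s p (x$1) * poly a (s p)) * (\<Sum>q\<le>K. lagrange K t q (x$2) * poly b (t q))"
    by (simp add: sum_product sum.cartesian_product case_prod_beta)
  finally show ?thesis
    using assms by (simp add: lagrange_interpolation_exact)
qed

text \<open>Partition of unity: exactness of interpolation for the constant polynomial 1 in both
  variables.\<close>

lemma sum_basis: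
  assumes "inj_on s {..K}" "inj_on t {..K}"
  shows "(\<Sum>\<alpha>\<in>node_index K. basis K s t \<alpha> x) = 1"
  using interpolant_tensor[OF assms, of 1 1 "1::real" x] by (simp add: interpolant_def)

lemma interpolant_sum:
  "interpolant K s t (\<lambda>\<alpha>. \<Sum>\<beta>\<in>B. f \<beta> \<alpha>) x = (\<Sum>\<beta>\<in>B. interpolant K s t (f \<beta>) x)"
  unfolding interpolant_def scaleR_sum_right by (rule sum.swap)

lemma interpolant_scaleR:
  "interpolant K s t (\<lambda>\<alpha>. u \<alpha> *\<^sub>R c) x = interpolant K s t u x *\<^sub>R c"
  by (simp add: interpolant_def scaleR_sum_left)

lemma interpolant_add:
  "interpolant K s t (\<lambda>\<alpha>. u \<alpha> + w \<alpha>) x = interpolant K s t u x + interpolant K s t w x"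
  by (simp add: interpolant_def scaleR_add_right sum.distrib)

lemma interpolant_cong:
  assumes "\<And>\<alpha>. \<alpha> \<in> node_index K \<Longrightarrow> u \<alpha> = w \<alpha>"
  shows "interpolant K s t u = interpolant K s t w"
  unfolding interpolant_def using assms by (intro ext sum.cong) auto

section \<open>Partial derivatives of basis functions and interpolants\<close>

text \<open>A partial derivative of a basis function is again a product of one-variable polynomials.
  The two factors are kept as a pair so that \<open>interpolant_tensor\<close> can be applied to
  them. The \<open>else\<close> branch is the case \<open>m = 2\<close>.\<close>

definition basis_pderiv_factors ::
  "nat \<Rightarrow> (nat \<Rightarrow> real) \<Rightarrow> (nat \<Rightarrow> real) \<Rightarrow> 2 \<Rightarrow> nat \<times> nat \<Rightarrow> real poly \<times> real poly" where
  "basis_pderiv_factors K s t m \<alpha> = (let a = lagrange_poly K s (fst \<alpha>); b = lagrange_poly K t (snd \<alpha>)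
     in if m = 1 then (pderiv a, b) else (a, pderiv b))"

lemma degree_basis_pderiv_factors:
  assumes "\<alpha> \<in> node_index K"
  shows "degree (fst (basis_pderiv_factors K s t m \<alpha>)) \<le> K" "degree (snd (basis_pderiv_factors K s t m \<alpha>)) \<le> K"
proof -
  have "degree (lagrange_poly K s (fst \<alpha>)) \<le> K" "degree (lagrange_poly K t (snd \<alpha>)) \<le> K"
    using assms by (auto simp: node_index_def intro: degree_lagrange_poly)
  then show "degree (fst (basis_pderiv_factors K s t m \<alpha>)) \<le> K"
    "degree (snd (basis_pderiv_factors K s t m \<alpha>)) \<le> K"
    by (auto simp: basis_pderiv_factors_def Let_def degree_pderiv)
qed

text \<open>Moving along one axis leaves the factor in the other variable fixed, so only a shifted
  one-variable polynomial is differentiated.\<close>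

lemma has_vector_derivative_basis:
  "((\<lambda>h. basis K s t \<alpha> (x + h *\<^sub>R axis m 1)) has_vector_derivative
     poly (fst (basis_pderiv_factors K s t m \<alpha>)) (x$1) * poly (snd (basis_pderiv_factors K s t m \<alpha>)) (x$2))
     (at 0)"
proof -
  have shift: "((\<lambda>h. poly a (y + h)) has_real_derivative poly (pderiv a) y) (at 0)"
    for a and y :: real
    by (auto intro!: derivative_eq_intros)
  consider "m = 1" | "m = 2"
    using exhaust_2 by blast
  then show ?thesis
    unfolding basis_def poly_lagrange_poly[symmetric] has_real_derivative_iff_has_vector_derivative[symmetric]
  proof cases
    case 1
    then show "((\<lambda>h. poly (lagrange_poly K s (fst \<alpha>)) ((x + h *\<^sub>R axis m 1) $ 1)
        * poly (lagrange_poly K t (snd \<alpha>)) ((x + h *\<^sub>R axis m 1) $ 2)) has_real_derivative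
        poly (fst (basis_pderiv_factors K s t m \<alpha>)) (x$1) * poly (snd (basis_pderiv_factors K s t m \<alpha>)) (x$2))
        (at 0)"
      using DERIV_cmult_right[OF shift] by (simp add: basis_pderiv_factors_def Let_def axis_def)
  next
    case 2
    then show "((\<lambda>h. poly (lagrange_poly K s (fst \<alpha>)) ((x + h *\<^sub>R axis m 1) $ 1)
        * poly (lagrange_poly K t (snd \<alpha>)) ((x + h *\<^sub>R axis m 1) $ 2)) has_real_derivative
        poly (fst (basis_pderiv_factors K s t m \<alpha>)) (x$1) * poly (snd (basis_pderiv_factors K s t m \<alpha>)) (x$2))
        (at 0)"
      using DERIV_cmult[OF shift] by (simp add: basis_pderiv_factors_def Let_def axis_def)
  qed
qed

lemma pderivative_basis:
  "pderivative m (basis K s t \<alpha>) x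
    = poly (fst (basis_pderiv_factors K s t m \<alpha>)) (x$1) * poly (snd (basis_pderiv_factors K s t m \<alpha>)) (x$2)"
  unfolding pderivative_def by (rule vector_derivative_at[OF has_vector_derivative_basis])

lemma pderivative_interpolant:
  "pderivative m (interpolant K s t u) x
    = (\<Sum>\<alpha>\<in>node_index K. pderivative m (basis K s t \<alpha>) x *\<^sub>R u \<alpha>)"
proof -
  have "((\<lambda>h. basis K s t \<alpha> (x + h *\<^sub>R axis m 1) *\<^sub>R u \<alpha>) has_vector_derivative
      pderivative m (basis K s t \<alpha>) x *\<^sub>R u \<alpha>) (at 0)" for \<alpha>
    unfolding pderivative_basis
    using has_vector_derivative_scaleR[OF
      has_vector_derivative_basis[folded has_real_derivative_iff_has_vector_derivative]
      has_vector_derivative_const[of "u \<alpha>"]] by simp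
  then show ?thesis
    unfolding pderivative_def interpolant_def
    by (intro vector_derivative_at has_vector_derivative_sum) (simp add: pderivative_def)
qed

text \<open>Differentiation does not raise the degree in either variable, so the derivative stays in
  the space that nodal interpolation reproduces. By linearity it suffices to treat each basis
  function.\<close>

lemma interpolant_pderivative_interpolant:
  assumes "inj_on s {..K}" "inj_on t {..K}"
  shows "interpolant K s t (\<lambda>\<alpha>. pderivative m (interpolant K s t u) (node s t \<alpha>)) x
    = pderivative m (interpolant K s t u) x"
  unfolding pderivative_interpolant interpolant_sum
proof (rule sum.cong[OF refl])
  fix \<beta> assume "\<beta> \<in> node_index K"
  then show "interpolant K s t (\<lambda>\<alpha>. pderivative m (basis K s t \<beta>) (node s t \<alpha>) *\<^sub>R u \<beta>) x
      = pderivative m (basis K s t \<beta>) x *\<^sub>R u \<beta>"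
    unfolding pderivative_basis node_def
    using interpolant_tensor[OF assms degree_basis_pderiv_factors] by simp
qed

lemma pderivative_interpolant_scaleR:
  fixes u :: "nat \<times> nat \<Rightarrow> real"
  shows "pderivative m (interpolant K s t (\<lambda>\<alpha>. u \<alpha> *\<^sub>R c)) x
    = pderivative m (interpolant K s t u) x *\<^sub>R c"
  by (simp add: pderivative_interpolant scaleR_sum_left)

lemma grad_interpolant:
  "grad (interpolant K s t u) x = (\<Sum>\<alpha>\<in>node_index K. u \<alpha> *\<^sub>R grad (basis K s t \<alpha>) x)"
  by (simp add: vec_eq_iff grad_def pderivative_interpolant sum_component mult.commute)

section \<open>Distinctness of the nodes; Euler fluxes and source at rest\<close>

lemma inj_on_cell_node:
  assumes "gauss_lobatto K \<xi>" "x i < x (Suc i)"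
  shows "inj_on (cell_node \<xi> x i) {..K}"
proof -
  have "inj_on \<xi> {..K}"
    using assms(1) by (auto simp: gauss_lobatto_def intro: strict_mono_on_imp_inj_on)
  then show ?thesis
    using assms(2) by (auto simp: inj_on_def cell_node_def)
qed

lemma vector_4:
  "(vector [a, b, c, d] :: 'a::zero^4) $ 1 = a"
  "(vector [a, b, c, d] :: 'a::zero^4) $ 2 = b"
  "(vector [a, b, c, d] :: 'a::zero^4) $ 3 = c"
  "(vector [a, b, c, d] :: 'a::zero^4) $ 4 = d"
  unfolding vector_def by simp_all

text \<open>Components 2 and 3 of a state are the momenta; at rest only the pressure term in one
  momentum row of each flux survives.\<close>

lemma flux1_at_rest: "velocity W = 0 \<Longrightarrow> flux1 \<gamma> W = pressure \<gamma> W *\<^sub>R axis 2 1"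
  by (simp add: flux1_def vec_eq_iff forall_4 vector_4 axis_def)

lemma flux2_at_rest: "velocity W = 0 \<Longrightarrow> flux2 \<gamma> W = pressure \<gamma> W *\<^sub>R axis 3 1"
  by (simp add: flux2_def vec_eq_iff forall_4 vector_4 axis_def)

lemma source_at_rest:
  "velocity W = 0 \<Longrightarrow> source W g = (- g$1) *\<^sub>R axis 2 1 + (- g$2) *\<^sub>R axis 3 1"
  by (simp add: source_def inner_vec_def vec_eq_iff forall_4 vector_4 axis_def)

section \<open>Discrete hydrostatic balance and vanishing residuals\<close>

text \<open>The identity holds at every point of the plane, because the partition of unity
  does.\<close>

lemma grad_pressure_h_isothermal:
  assumes inj: "inj_on s {..K}" "inj_on t {..K}"
    and pos: "0 < \<rho>\<^sub>r" "0 < p\<^sub>r"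
    and dens: "\<And>\<alpha>. \<alpha> \<in> node_index K \<Longrightarrow> 0 < mass_density (W (node s t \<alpha>))"
    and isothermal: "\<And>\<alpha>. \<alpha> \<in> node_index K \<Longrightarrow>
           pressure \<gamma> (W (node s t \<alpha>)) / p\<^sub>r = mass_density (W (node s t \<alpha>)) / \<rho>\<^sub>r"
    and equilibrium: "\<And>\<alpha>. \<alpha> \<in> node_index K \<Longrightarrow>
           kappa \<rho>\<^sub>r p\<^sub>r (mass_density (W (node s t \<alpha>))) (\<phi> (node s t \<alpha>)) = \<kappa>\<^sub>0"
  shows "grad (pressure_h K s t \<gamma> W) x = - gravity K s t \<rho>\<^sub>r p\<^sub>r W \<phi> x"
proof -
  define e where "e \<beta> = exp (- \<rho>\<^sub>r * \<phi> (node s t \<beta>) / p\<^sub>r)" for \<beta>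
  have pressure: "pressure \<gamma> (W (node s t \<beta>)) = p\<^sub>r / \<rho>\<^sub>r * exp (\<kappa>\<^sub>0 / p\<^sub>r) * e \<beta>"
    if \<beta>: "\<beta> \<in> node_index K" for \<beta>
  proof -
    let ?r = "mass_density (W (node s t \<beta>))"
    have "ln ?r = \<kappa>\<^sub>0 / p\<^sub>r + - \<rho>\<^sub>r * \<phi> (node s t \<beta>) / p\<^sub>r"
      using equilibrium[OF \<beta>] pos by (simp add: kappa_def field_simps)
    \<comment> \<open>Exponentiating the solved equation for \<open>kappa\<close> gives the nodal
      density, as positivity makes \<open>exp (ln ?r)\<close> equal to \<open>?r\<close>.\<close>
    then have "exp (ln ?r) = exp (\<kappa>\<^sub>0 / p\<^sub>r) * e \<beta>"
      unfolding e_def by (simp only: exp_add)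
    then have "?r = exp (\<kappa>\<^sub>0 / p\<^sub>r) * e \<beta>"
      using dens[OF \<beta>] by simp
    then show ?thesis
      using isothermal[OF \<beta>] pos by (simp add: field_simps)
  qed
  have "gravity K s t \<rho>\<^sub>r p\<^sub>r W \<phi> x
      = - (p\<^sub>r / \<rho>\<^sub>r) *\<^sub>R (\<Sum>\<alpha>\<in>node_index K. \<Sum>\<beta>\<in>node_index K.
          (basis K s t \<alpha> x * exp (\<kappa>\<^sub>0 / p\<^sub>r) * e \<beta>) *\<^sub>R grad (basis K s t \<beta>) x)"
    unfolding gravity_def e_def by (simp add: equilibrium cong: sum.cong)
  \<comment> \<open>Each summand is now a factor in \<alpha> times a factor in \<beta>, so the
    double sum splits.\<close>
  also have "\<dots> = - (p\<^sub>r / \<rho>\<^sub>r) *\<^sub>R ((\<Sum>\<alpha>\<in>node_index K. basis K s t \<alpha> x) *\<^sub>R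
      (\<Sum>\<beta>\<in>node_index K. (exp (\<kappa>\<^sub>0 / p\<^sub>r) * e \<beta>) *\<^sub>R grad (basis K s t \<beta>) x))"
    unfolding scaleR_sum_left by (simp add: scaleR_sum_right mult.assoc)
  also have "\<dots> = - (\<Sum>\<beta>\<in>node_index K.
      (p\<^sub>r / \<rho>\<^sub>r * exp (\<kappa>\<^sub>0 / p\<^sub>r) * e \<beta>) *\<^sub>R grad (basis K s t \<beta>) x)"
    by (simp add: sum_basis[OF inj] scaleR_sum_right sum_negf mult.assoc)
  also have "\<dots> = - grad (pressure_h K s t \<gamma> W) x"
    unfolding pressure_h_def grad_interpolant by (simp add: pressure cong: sum.cong)
  finally show ?thesis by simp
qed

text \<open>The source sees gravity only through its nodal values. There \<open>balance\<close>
  turns them into derivatives of the discrete pressure, which interpolation then returns unchanged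
  at every \<open>x\<close>.\<close>

lemma flux_divergence_eq_source_h:
  assumes inj: "inj_on s {..K}" "inj_on t {..K}"
    and rest: "\<And>\<alpha>. \<alpha> \<in> node_index K \<Longrightarrow> velocity (W (node s t \<alpha>)) = 0"
    and balance: "\<And>x. grad (pressure_h K s t \<gamma> W) x = - gravity K s t \<rho>\<^sub>r p\<^sub>r W \<phi> x"
  shows "pderivative 1 (flux1_h K s t \<gamma> W) x + pderivative 2 (flux2_h K s t \<gamma> W) x
    = source_h K s t \<rho>\<^sub>r p\<^sub>r W \<phi> x"
proof -
  let ?p = "pressure_h K s t \<gamma> W"
  have grav: "- gravity K s t \<rho>\<^sub>r p\<^sub>r W \<phi> y $ m = pderivative m ?p y" for m y
    using arg_cong[OF balance, of "\<lambda>g. g $ m"] by (simp add: grad_def)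
  have "flux1_h K s t \<gamma> W
      = interpolant K s t (\<lambda>\<alpha>. pressure \<gamma> (W (node s t \<alpha>)) *\<^sub>R axis 2 1)"
    unfolding flux1_h_def by (rule interpolant_cong) (simp add: flux1_at_rest rest)
  then have 1: "pderivative 1 (flux1_h K s t \<gamma> W) x = pderivative 1 ?p x *\<^sub>R axis 2 1"
    by (simp add: pderivative_interpolant_scaleR pressure_h_def)
  have "flux2_h K s t \<gamma> W
      = interpolant K s t (\<lambda>\<alpha>. pressure \<gamma> (W (node s t \<alpha>)) *\<^sub>R axis 3 1)"
    unfolding flux2_h_def by (rule interpolant_cong) (simp add: flux2_at_rest rest)
  then have 2: "pderivative 2 (flux2_h K s t \<gamma> W) x = pderivative 2 ?p x *\<^sub>R axis 3 1"
    by (simp add: pderivative_interpolant_scaleR pressure_h_def)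
  have "source_h K s t \<rho>\<^sub>r p\<^sub>r W \<phi> = interpolant K s t (\<lambda>\<alpha>.
      pderivative 1 ?p (node s t \<alpha>) *\<^sub>R axis 2 1 + pderivative 2 ?p (node s t \<alpha>) *\<^sub>R axis 3 1)"
    unfolding source_h_def
    by (rule interpolant_cong) (simp only: source_at_rest rest grav)
  then have "source_h K s t \<rho>\<^sub>r p\<^sub>r W \<phi> x
      = pderivative 1 ?p x *\<^sub>R axis 2 1 + pderivative 2 ?p x *\<^sub>R axis 3 1"
    by (simp only: interpolant_add interpolant_scaleR pressure_h_def
        interpolant_pderivative_interpolant[OF inj])
  with 1 2 show ?thesis by simp
qed

theorem mainTheorem3:
  fixes K N1 N2 i j :: nat
    and \<xi> x1 x2 s t :: "nat \<Rightarrow> real"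
    and \<gamma> \<rho>\<^sub>r p\<^sub>r \<kappa>\<^sub>0 :: real
    and W :: "real^2 \<Rightarrow> real^4"
    and \<phi> :: "real^2 \<Rightarrow> real"
  assumes "1 \<le> K" and "gauss_lobatto K \<xi>"
    and "strict_mono_on {..N1} x1" and "strict_mono_on {..N2} x2"
    and "i < N1" and "j < N2"
    and "s = cell_node \<xi> x1 i" and "t = cell_node \<xi> x2 j"
    and "0 < \<rho>\<^sub>r" and "0 < p\<^sub>r"
    and "\<forall>\<alpha>\<in>node_index K. 0 < mass_density (W (node s t \<alpha>))"
    and "\<forall>\<alpha>\<in>node_index K. velocity (W (node s t \<alpha>)) = 0"
    and "\<forall>\<alpha>\<in>node_index K.
           pressure \<gamma> (W (node s t \<alpha>)) / p\<^sub>r = mass_density (W (node s t \<alpha>)) / \<rho>\<^sub>r"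
    and "\<forall>\<alpha>\<in>node_index K.
           kappa \<rho>\<^sub>r p\<^sub>r (mass_density (W (node s t \<alpha>))) (\<phi> (node s t \<alpha>)) = \<kappa>\<^sub>0"
  shows "(\<forall>x\<in>element x1 x2 i j.
            grad (pressure_h K s t \<gamma> W) x = - gravity K s t \<rho>\<^sub>r p\<^sub>r W \<phi> x)
       \<and> (\<forall>p\<le>K. \<forall>q\<le>K.
            flux_residual K s t \<gamma> W p q + source_residual K s t \<rho>\<^sub>r p\<^sub>r W \<phi> p q = 0)"
proof -
  \<comment> \<open>\<open>i < N1\<close> and \<open>j < N2\<close> keep \<open>Suc i\<close> and
    \<open>Suc j\<close> within the ranges of monotonicity.\<close>
  have "x1 i < x1 (Suc i)" "x2 j < x2 (Suc j)"
    using assms(3-6) by (auto intro: strict_mono_onD)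
  then have inj: "inj_on s {..K}" "inj_on t {..K}"
    using assms(2,7,8) inj_on_cell_node by auto
  have balance: "grad (pressure_h K s t \<gamma> W) x = - gravity K s t \<rho>\<^sub>r p\<^sub>r W \<phi> x" for x
    by (rule grad_pressure_h_isothermal[OF inj]) (use assms(9-) in auto)
  \<comment> \<open>The integrands are equal pointwise, so the two residuals are the same iterated
    integral with opposite signs.\<close>
  have "flux_residual K s t \<gamma> W p q + source_residual K s t \<rho>\<^sub>r p\<^sub>r W \<phi> p q = 0" for p q
    using flux_divergence_eq_source_h[OF inj _ balance] assms(12)
    by (simp add: flux_residual_def source_residual_def)
  with balance show ?thesis by blast
qed

end
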